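(* Let $0\leqslant\alpha<1$, $\beta>0$ and let $n\geqslant 1$ be an integer. Let $\mathcal{F}_{\alpha,\beta,n}$ be the family of all functions $F(z)=f(z)(Q(z))^{\beta/n}$ on $\mathbb{D}$, where $f\in\mathcal{ST}(\alpha)$ and $Q$ is a polynomial of degree $n$ with $Q(0)=1$ and all zeros in $\mathbb{C}\setminus\mathbb{D}$. Then the $\mathcal{S}^{*}_{c}$-radius of this family, that is, the largest $R\in(0,1)$ such that $z\mapsto r^{-1}F(rz)$ belongs to $\mathcal{S}^{*}_{c}$ for all $F\in\mathcal{F}_{\alpha,\beta,n}$ and all $0<r<R$, is \[R_{\mathcal{S}^{*}_{c}}(F)=\begin{cases}\sigma_0 & \text{if } 2\alpha+\beta-2\geqslant 0,\\ \sigma_0 & \text{if } 2\alpha+\beta-2<0 \text{ and } X(\alpha,\beta)\leqslant 0,\\ \tilde{\sigma}_0 & \text{if } 2\alpha+\beta-2<0 \text{ and } X(\alpha,\beta)>0,\end{cases}\] where \[\sigma_0=\dfrac{4}{3(2-2\alpha+\beta)+\sqrt{(6-6\alpha+3\beta)^2+8(6\alpha+3\beta-4)}},\] \[\tilde{\sigma}_0=\dfrac{4}{(2-2\alpha+\beta)+\sqrt{(2-2\alpha+\beta)^2-8(2\alpha+\beta-4)}},\] and \[\begin{aligned}X(\alpha,\beta)={}&2(8-6\alpha-3\beta)(6\alpha-6-3\beta)\Bigl(6\alpha-6-3\beta+\sqrt{(6-6\alpha+3\beta)^2+8(6\alpha+3\beta-4)}\Bigr)\\&+48(6\alpha+3\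beta-4)(2-2\alpha-\beta).\end{aligned}\]
   Context: $\mathbb{D}=\{z\in\mathbb{C}:|z|<1\}$. $\mathcal{A}$ is the class of analytic functions $f$ on $\mathbb{D}$ with $f(0)=0$, $f'(0)=1$. For $0\leqslant\alpha<1$, $\mathcal{ST}(\alpha)$ (starlike functions of order $\alpha$) is the class of $f\in\mathcal{A}$ with $\operatorname{Re}(zf'(z)/f(z))>\alpha$ for all $z\in\mathbb{D}$ (the quotient being given the value $1$ at $z=0$). For analytic $g,h$ on $\mathbb{D}$, $g\prec h$ (subordination) means $g=h\circ w$ for some analytic $w:\mathbb{D}\to\mathbb{D}$ with $w(0)=0$. $\mathcal{S}^{*}_{c}$ (starlike functions associated with a cardioid) is the class of $f\in\mathcal{A}$ with $zf'(z)/f(z)\prec\varphi_c(z)$, where $\varphi_c(z)=1+\frac{4}{3}z+\frac{2}{3}z^2$. Since $Q$ is non-vanishing in $\mathbb{D}$ and $Q(0)=1$, $(Q(z))^{\beta/n}$ denotes the analytic branch on $\mathbb{D}$ equal to $1$ at $z=0$, so $F\in\mathcal{A}$.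
   Formalization: When 6α+3β=4, it is additionally assumed that α ≤ (5−√2)/6; for larger α on that line X(α,β)=0, so the stated formula selects σ₀, although the true radius is the smaller σ̃₀ (e.g. α=13/20, β=1/30). *)

theory Defs
  imports "HOL-Complex_Analysis.Complex_Analysis"
begin

abbreviation unit_disc :: "complex set" where
  "unit_disc \<equiv> ball 0 1"

definition class_A :: "(complex \<Rightarrow> complex) set" where
  "class_A = {f. f holomorphic_on unit_disc \<and> f 0 = 0 \<and> deriv f 0 = 1}"

text \<open>The quotient \<open>z f'(z) / f(z)\<close>, with its removable singularity at 0 filled in. It is a
  function on the whole disc only if \<open>f\<close> has no zero in the punctured disc; the classes below
  require this explicitly, so that the convention \<open>x / 0 = 0\<close> plays no role.\<close>

definition starlike_quot :: "(complex \<Rightarrow> complex) \<Rightarrow> complex \<Rightarrow> complex" where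
  "starlike_quot f z = (if z = 0 then 1 else z * deriv f z / f z)"

definition nonvanishing_punctured :: "(complex \<Rightarrow> complex) \<Rightarrow> bool" where
  "nonvanishing_punctured f \<longleftrightarrow> (\<forall>z \<in> unit_disc - {0}. f z \<noteq> 0)"

definition starlike_of_order :: "real \<Rightarrow> (complex \<Rightarrow> complex) set" where
  "starlike_of_order \<alpha> =
     {f \<in> class_A. nonvanishing_punctured f \<and> (\<forall>z \<in> unit_disc. Re (starlike_quot f z) > \<alpha>)}"

definition subordinate :: "(complex \<Rightarrow> complex) \<Rightarrow> (complex \<Rightarrow> complex) \<Rightarrow> bool" where
  "subordinate g h \<longleftrightarrow>
     g holomorphic_on unit_disc \<and> h holomorphic_on unit_disc \<and>
     (\<exists>w. w holomorphic_on unit_disc \<and> w ` unit_disc \<subseteq> unit_disc \<and> w 0 = 0 \<and>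
          (\<forall>z \<in> unit_disc. g z = h (w z)))"

definition cardioid_map :: "complex \<Rightarrow> complex" where
  "cardioid_map z = 1 + 4 / 3 * z + 2 / 3 * z ^ 2"

definition starlike_cardioid :: "(complex \<Rightarrow> complex) set" where
  "starlike_cardioid =
     {f \<in> class_A. nonvanishing_punctured f \<and> subordinate (starlike_quot f) cardioid_map}"

text \<open>\<open>g\<close> is, on the disc, the analytic branch of \<open>q\<^sup>c\<close> with value 1 at 0 (for \<open>q 0 = 1\<close>), namely
  \<open>exp (c * L)\<close> for the analytic logarithm \<open>L\<close> of \<open>q\<close> with \<open>L 0 = 0\<close>. The pointwise principal
  power \<open>powr\<close> would in general be discontinuous, as \<open>q\<close> may cross the negative real axis.\<close>

definition is_power_branch ::
  "(complex \<Rightarrow> complex) \<Rightarrow> (complex \<Rightarrow> complex) \<Rightarrow> real \<Rightarrow> bool" where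
  "is_power_branch g q c \<longleftrightarrow>
     (\<exists>L. L holomorphic_on unit_disc \<and> L 0 = 0 \<and>
          (\<forall>z \<in> unit_disc. exp (L z) = q z \<and> g z = exp (of_real c * L z)))"

definition family_F :: "real \<Rightarrow> real \<Rightarrow> nat \<Rightarrow> (complex \<Rightarrow> complex) set" where
  "family_F \<alpha> \<beta> n =
     {F. \<exists>f (Q :: complex poly) g.
           f \<in> starlike_of_order \<alpha> \<and>
           degree Q = n \<and> poly Q 0 = 1 \<and> (\<forall>z. poly Q z = 0 \<longrightarrow> z \<notin> unit_disc) \<and>
           is_power_branch g (poly Q) (\<beta> / real n) \<and>
           (\<forall>z \<in> unit_disc. F z = f z * g z)}"

definition dilation :: "real \<Rightarrow> (complex \<Rightarrow> complex) \<Rightarrow> complex \<Rightarrow> complex" where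
  "dilation r F z = F (of_real r * z) / of_real r"

definition radius_admissible ::
  "(complex \<Rightarrow> complex) set \<Rightarrow> (complex \<Rightarrow> complex) set \<Rightarrow> real \<Rightarrow> bool" where
  "radius_admissible S \<F> R \<longleftrightarrow> 0 < R \<and> R < 1 \<and> (\<forall>F \<in> \<F>. \<forall>r. 0 < r \<and> r < R \<longrightarrow> dilation r F \<in> S)"

text \<open>\<open>is_radius S \<F> R\<close>: the \<open>S\<close>-radius of the family \<open>\<F>\<close> exists and equals \<open>R\<close>.\<close>

definition is_radius ::
  "(complex \<Rightarrow> complex) set \<Rightarrow> (complex \<Rightarrow> complex) set \<Rightarrow> real \<Rightarrow> bool" where
  "is_radius S \<F> R \<longleftrightarrow>
     radius_admissible S \<F> R \<and> (\<forall>R'. radius_admissible S \<F> R' \<longrightarrow> R' \<le> R)"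

definition sigma0 :: "real \<Rightarrow> real \<Rightarrow> real" where
  "sigma0 \<alpha> \<beta> =
     4 / (3 * (2 - 2*\<alpha> + \<beta>) + sqrt ((6 - 6*\<alpha> + 3*\<beta>)^2 + 8 * (6*\<alpha> + 3*\<beta> - 4)))"

definition sigma0_tilde :: "real \<Rightarrow> real \<Rightarrow> real" where
  "sigma0_tilde \<alpha> \<beta> =
     4 / ((2 - 2*\<alpha> + \<beta>) + sqrt ((2 - 2*\<alpha> + \<beta>)^2 - 8 * (2*\<alpha> + \<beta> - 4)))"

text \<open>Up to a factor \<open>(6\<alpha> + 3\<beta> - 4)\<^sup>2\<close>, the sign of \<open>X_crit \<alpha> \<beta>\<close> is that of
  \<open>sigma0 \<alpha> \<beta> - sigma0_tilde \<alpha> \<beta>\<close> (for \<open>2\<alpha> + \<beta> < 2\<close>). Because of that factor \<open>X_crit\<close> vanishes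
  identically on the line \<open>6\<alpha> + 3\<beta> = 4\<close>, where its sign therefore decides nothing: there
  \<open>sigma0 \<alpha> \<beta> \<le> sigma0_tilde \<alpha> \<beta>\<close> holds exactly when \<open>\<alpha> \<le> (5 - sqrt 2) / 6\<close>.\<close>

definition X_crit :: "real \<Rightarrow> real \<Rightarrow> real" where
  "X_crit \<alpha> \<beta> =
     2 * (8 - 6*\<alpha> - 3*\<beta>) * (6*\<alpha> - 6 - 3*\<beta>) *
       (6*\<alpha> - 6 - 3*\<beta> + sqrt ((6 - 6*\<alpha> + 3*\<beta>)^2 + 8 * (6*\<alpha> + 3*\<beta> - 4)))
     + 48 * (6*\<alpha> + 3*\<beta> - 4) * (2 - 2*\<alpha> - \<beta>)"

end

theory Submission
  imports Defs "HOL-Computational_Algebra.Fundamental_Theorem_Algebra"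
begin

text \<open>By the Schwarz lemma and the factorisation of \<open>Q\<close> into linear factors, \<open>z F'(z) / F(z)\<close> for
  \<open>|z| = s\<close> lies in the disc with centre \<open>a = (1 + (1 - 2\<alpha> - \<beta>) s\<^sup>2) / (1 - s\<^sup>2)\<close> and radius
  \<open>\<rho> = (2 - 2\<alpha> + \<beta>) s / (1 - s\<^sup>2)\<close>. The cardioid domain is the image of the disc \<open>|\<zeta> - 1| < 1\<close>
  under \<open>1/3 + (2/3) \<zeta>\<^sup>2\<close>, and a disc centred on the real axis lies in it as soon as it
  lies between the real points \<open>1/3\<close> and \<open>3\<close>, i.e. \<open>\<rho> < a - 1/3\<close> and \<open>\<rho> < 3 - a\<close>. The
  two conditions break down at \<open>s = sigma0\<close> and \<open>s = sigma0_tilde\<close> respectively, so the radius is their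
  minimum; the sign of \<open>X_crit\<close> decides which one it is. It is sharp because
  \<open>F(z) = z (1 + z)\<^sup>\<beta> (1 - z)\<^bsup>2\<alpha> - 2\<^esup>\<close> has \<open>z F'(z) / F(z) = 1/3\<close> at \<open>-sigma0\<close> and \<open>3\<close> at
  \<open>sigma0_tilde\<close>, two boundary values that the cardioid map does not take in the disc.\<close>

section \<open>The radii as roots of quadratic equations\<close>

text \<open>The smallest positive root of \<open>B r\<^sup>2 + A r = 2\<close>, rationalised so that \<open>B = 0\<close> is allowed.\<close>

definition quad_root :: "real \<Rightarrow> real \<Rightarrow> real" where
  "quad_root A B = 4 / (A + sqrt (A\<^sup>2 + 8 * B))"

text \<open>The quadratic is 2 at 0, and \<open>A + B > 2\<close> makes it negative at 1, so it has
  exactly one root in (0, 1). The sign rule \<open>quad_sgn\<close> turns comparisons with the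
  radius into inequalities for the quadratic; \<open>quad_root_sqrt\<close> serves to remove the
  square root from \<open>X_crit\<close>.\<close>

lemma quad_root:
  assumes A: "A > 0" and AB: "A + B > 2"
  shows quad_root_pos: "quad_root A B > 0"
    and quad_root_less_1: "quad_root A B < 1"
    and quad_root_eq: "2 - A * quad_root A B - B * (quad_root A B)\<^sup>2 = 0"
    and quad_sgn: "\<And>r. 0 \<le> r \<Longrightarrow> r \<le> 1 \<Longrightarrow> sgn (2 - A * r - B * r\<^sup>2) = sgn (quad_root A B - r)"
    and quad_root_sqrt: "sqrt (A\<^sup>2 + 8 * B) - A = 2 * B * quad_root A B"
proof -
  define S where "S = sqrt (A\<^sup>2 + 8 * B)"
  define \<sigma> where "\<sigma> = quad_root A B"
  have \<sigma>: "\<sigma> = 4 / (A + S)"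
    by (simp add: \<sigma>_def S_def quad_root_def)
  \<comment> \<open>This is \<open>A + B > 2\<close> in another form. Of the resulting bounds, S > 4
    - A places the root below 1, and S > A - 4 gives \<open>l 1 > 0\<close> below.\<close>
  have "\<bar>A - 4\<bar>\<^sup>2 < A\<^sup>2 + 8 * B"
    using AB by (simp add: power2_eq_square algebra_simps)
  then have SA: "\<bar>A - 4\<bar> < S"
    unfolding S_def by (rule real_less_rsqrt)
  then have S: "S > 0" "A + S > 4" "S > A - 4" by linarith+
  have S2: "S\<^sup>2 = A\<^sup>2 + 8 * B"
    using \<open>\<bar>A - 4\<bar>\<^sup>2 < A\<^sup>2 + 8 * B\<close> unfolding S_def
    by (smt (verit) real_sqrt_pow2 zero_le_power2)
  show pos: "quad_root A B > 0" and less: "quad_root A B < 1"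
    using S A unfolding \<sigma>_def[symmetric] \<sigma> by auto
  have "A + S \<noteq> 0" using S by simp
  then have T\<sigma>: "(A + S) * \<sigma> = 4"
    unfolding \<sigma> by (metis nonzero_mult_div_cancel_left times_divide_eq_right)
  have "(A + S)\<^sup>2 * (2 - A * \<sigma> - B * \<sigma>\<^sup>2) =
        2 * (A + S)\<^sup>2 - A * (A + S) * ((A + S) * \<sigma>) - B * ((A + S) * \<sigma>)\<^sup>2"
    by (simp add: power2_eq_square algebra_simps)
  also have "\<dots> = 0"
    unfolding T\<sigma> using S2 by (simp add: power2_eq_square algebra_simps)
  finally show root: "2 - A * quad_root A B - B * (quad_root A B)\<^sup>2 = 0"
    using S A by (simp add: \<sigma>_def)
  have "(S - A) * (A + S) = 8 * B"
    using S2 by (simp add: power2_eq_square algebra_simps)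
  then have "(S - A) * ((A + S) * \<sigma>) = 8 * B * \<sigma>" by (simp flip: mult.assoc)
  then show "sqrt (A\<^sup>2 + 8 * B) - A = 2 * B * quad_root A B"
    unfolding T\<sigma> by (simp add: S_def \<sigma>_def)
  fix r :: real assume r: "0 \<le> r" "r \<le> 1"
  \<comment> \<open>Up to the factor \<open>\<sigma>\<^sup>2\<close>, \<open>l\<close> is the
    cofactor of \<sigma> - r in the quadratic. It is affine and positive at 0 and at 1, hence on
    [0, 1], so \<sigma> - r alone decides the sign.\<close>
  define l where "l = (\<lambda>r. 2 * \<sigma> + r * (2 - A * \<sigma>))"
  have "(A + S) * l 1 = 2 * ((A + S) * \<sigma>) + 2 * (A + S) - A * ((A + S) * \<sigma>)"
    by (simp add: l_def algebra_simps)
  also have "\<dots> > 0" unfolding T\<sigma> using S by simp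
  finally have l1: "l 1 > 0" using S by (simp add: zero_less_mult_iff)
  have l: "l r = (1 - r) * (2 * \<sigma>) + r * l 1" by (simp add: l_def algebra_simps)
  have "l r > 0"
  proof (cases "r = 1")
    case False
    then have "(1 - r) * (2 * \<sigma>) > 0" using r pos by (simp add: \<sigma>_def)
    moreover have "r * l 1 \<ge> 0" using r l1 by simp
    ultimately show ?thesis unfolding l by linarith
  qed (use l1 in simp)
  moreover have "\<sigma>\<^sup>2 * (2 - A * r - B * r\<^sup>2) = (\<sigma> - r) * l r"
  proof -
    have "B * \<sigma>\<^sup>2 = 2 - A * \<sigma>" using root by (simp add: \<sigma>_def)
    moreover have "\<sigma>\<^sup>2 * (2 - A * r - B * r\<^sup>2) = 2 * \<sigma>\<^sup>2 - A * r * \<sigma>\<^sup>2 - r\<^sup>2 * (B * \<sigma>\<^sup>2)"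
      by (simp add: algebra_simps)
    ultimately show ?thesis by (simp only:) (simp add: l_def power2_eq_square algebra_simps)
  qed
  moreover have "\<sigma>\<^sup>2 > 0" using pos by (simp add: \<sigma>_def)
  ultimately show "sgn (2 - A * r - B * r\<^sup>2) = sgn (quad_root A B - r)"
    unfolding \<sigma>_def[symmetric]
    by (metis mult.right_neutral mult_1 sgn_mult sgn_pos)
qed

lemma sigma0_eq: "sigma0 \<alpha> \<beta> = quad_root (6 - 6 * \<alpha> + 3 * \<beta>) (6 * \<alpha> + 3 * \<beta> - 4)"
  by (simp add: sigma0_def quad_root_def algebra_simps)

lemma sigma0_tilde_eq: "sigma0_tilde \<alpha> \<beta> = quad_root (2 - 2 * \<alpha> + \<beta>) (4 - 2 * \<alpha> - \<beta>)"
  by (simp add: sigma0_tilde_def quad_root_def algebra_simps)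

text \<open>By \<open>quad_sgn\<close> the comparison is the sign at \<open>sigma0\<close> of the
  quadratic belonging to \<open>sigma0_tilde\<close>. Three times that quadratic has the same linear
  term as the one vanishing at \<open>sigma0\<close>, so subtraction leaves only a constant and a
  square.\<close>

lemma sigma0_le_sigma0_tilde_iff:
  assumes "\<alpha> < 1" "\<beta> > 0"
  shows "sigma0 \<alpha> \<beta> \<le> sigma0_tilde \<alpha> \<beta> \<longleftrightarrow> (8 - 6 * \<alpha> - 3 * \<beta>) * (sigma0 \<alpha> \<beta>)\<^sup>2 \<le> 2"
proof -
  define s where "s = sigma0 \<alpha> \<beta>"
  let ?P = "2 - (2 - 2 * \<alpha> + \<beta>) * s - (4 - 2 * \<alpha> - \<beta>) * s\<^sup>2"
  have A: "6 - 6 * \<alpha> + 3 * \<beta> > 0" "6 - 6 * \<alpha> + 3 * \<beta> + (6 * \<alpha> + 3 * \<beta> - 4) > 2"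
    and A': "2 - 2 * \<alpha> + \<beta> > 0" "2 - 2 * \<alpha> + \<beta> + (4 - 2 * \<alpha> - \<beta>) > 2"
    using assms by auto
  have s: "0 < s" "s < 1" "2 - (6 - 6 * \<alpha> + 3 * \<beta>) * s - (6 * \<alpha> + 3 * \<beta> - 4) * s\<^sup>2 = 0"
    unfolding s_def sigma0_eq using quad_root[OF A] by auto
  have "sgn ?P = sgn (sigma0_tilde \<alpha> \<beta> - s)"
    unfolding sigma0_tilde_eq using quad_sgn[OF A'] s by simp
  moreover have "3 * ?P = 4 - 2 * ((8 - 6 * \<alpha> - 3 * \<beta>) * s\<^sup>2)"
    using s(3) by (simp add: algebra_simps)
  ultimately show ?thesis
    unfolding s_def[symmetric] by (auto simp: sgn_if split: if_splits)
qed

text \<open>With B = 6\<alpha> + 3\<beta> - 4, the bracket containing the square root is 2 B s, and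
  the remaining product A s is eliminated by the equation for s. The sign of \<open>X_crit\<close>
  is thus the criterion of the preceding lemma, except where B = 0.\<close>

lemma X_crit_eq:
  assumes "\<alpha> < 1" "\<beta> > 0"
  shows "X_crit \<alpha> \<beta> =
         4 * (6 * \<alpha> + 3 * \<beta> - 4)\<^sup>2 * ((8 - 6 * \<alpha> - 3 * \<beta>) * (sigma0 \<alpha> \<beta>)\<^sup>2 - 2)"
proof -
  define s where "s = sigma0 \<alpha> \<beta>"
  define A B where "A = 6 - 6 * \<alpha> + 3 * \<beta>" and "B = 6 * \<alpha> + 3 * \<beta> - 4"
  have A: "A > 0" "A + B > 2" using assms by (auto simp: A_def B_def)
  have s: "2 - A * s - B * s\<^sup>2 = 0" "sqrt (A\<^sup>2 + 8 * B) - A = 2 * B * s"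
    using quad_root[OF A] unfolding s_def sigma0_eq A_def[symmetric] B_def[symmetric] by auto
  have X: "X_crit \<alpha> \<beta> = 2 * (4 - B) * (- A) * (sqrt (A\<^sup>2 + 8 * B) - A) + 16 * B * (2 - B)"
    by (simp add: X_crit_def A_def B_def algebra_simps)
  have "X_crit \<alpha> \<beta> = - 4 * (4 - B) * B * (A * s) + 16 * B * (2 - B)"
    unfolding X s(2) by (simp add: algebra_simps)
  also have "A * s = 2 - B * s\<^sup>2" using s(1) by simp
  also have "- 4 * (4 - B) * B * (2 - B * s\<^sup>2) + 16 * B * (2 - B) = 4 * B\<^sup>2 * ((4 - B) * s\<^sup>2 - 2)"
    by (simp add: power2_eq_square algebra_simps)
  finally show ?thesis by (simp add: B_def s_def)
qed

lemma radius_eq_min: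
  assumes "\<alpha> < 1" "\<beta> > 0"
    and deg: "6*\<alpha> + 3*\<beta> = 4 \<longrightarrow> \<alpha> \<le> (5 - sqrt 2) / 6"
  shows "(if 2*\<alpha> + \<beta> - 2 \<ge> 0 then sigma0 \<alpha> \<beta>
            else if X_crit \<alpha> \<beta> \<le> 0 then sigma0 \<alpha> \<beta>
            else sigma0_tilde \<alpha> \<beta>) = min (sigma0 \<alpha> \<beta>) (sigma0_tilde \<alpha> \<beta>)"
proof -
  define s where "s = sigma0 \<alpha> \<beta>"
  define D where "D = 8 - 6 * \<alpha> - 3 * \<beta>"
  note iff = sigma0_le_sigma0_tilde_iff[OF assms(1,2), folded s_def D_def]
  note X = X_crit_eq[OF assms(1,2), folded s_def D_def]
  have A: "6 - 6 * \<alpha> + 3 * \<beta> > 0" "6 - 6 * \<alpha> + 3 * \<beta> + (6 * \<alpha> + 3 * \<beta> - 4) > 2"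
    using assms by auto
  have s: "0 < s" "s < 1"
    unfolding s_def sigma0_eq using quad_root[OF A] by auto
  consider "2*\<alpha> + \<beta> \<ge> 2" | "2*\<alpha> + \<beta> < 2" "6*\<alpha> + 3*\<beta> \<noteq> 4" | "2*\<alpha> + \<beta> < 2" "6*\<alpha> + 3*\<beta> = 4"
    by linarith
  then show ?thesis
  proof cases
    case 1
    \<comment> \<open>Here \<open>D \<le> 2\<close> and s < 1, so the criterion holds
      automatically.\<close>
    have "D * s\<^sup>2 \<le> 2 * s\<^sup>2" using 1 by (intro mult_right_mono) (auto simp: D_def)
    also have "s\<^sup>2 \<le> 1" using s by (simp add: power_le_one)
    finally show ?thesis using 1 iff by (simp add: s_def)
  next
    case 2
    then have "X_crit \<alpha> \<beta> \<le> 0 \<longleftrightarrow> D * s\<^sup>2 \<le> 2"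
      unfolding X by (simp add: mult_le_0_iff)
    then show ?thesis using 2 iff by (simp add: s_def min_def)
  next
    case 3
    then have \<beta>: "3 * \<beta> = 4 - 6 * \<alpha>" and "\<alpha> < 2/3" using assms(2) by auto
    \<comment> \<open>The quadratic is linear on this line, with root 1 / (5 - 6\<alpha>). Since D =
      4 there, the criterion reads \<open>2 \<le> (5 - 6 * \<alpha>)\<^sup>2\<close>, which is what
      \<open>deg\<close> supplies.\<close>
    have "s = 4 / (2 * (10 - 12 * \<alpha>))"
      unfolding s_def sigma0_eq quad_root_def using \<beta> \<open>\<alpha> < 2/3\<close> by simp
    then have s1: "(5 - 6 * \<alpha>) * s = 1" using \<open>\<alpha> < 2/3\<close> by (simp add: field_simps)
    have "sqrt 2 \<le> 5 - 6 * \<alpha>" using deg 3(2) by simp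
    then have "2 \<le> (5 - 6 * \<alpha>)\<^sup>2" by (metis real_sqrt_ge_zero real_sqrt_pow2 power_mono zero_le_numeral)
    then have "2 * s\<^sup>2 \<le> ((5 - 6 * \<alpha>) * s)\<^sup>2"
      by (simp add: power_mult_distrib mult_right_mono)
    then have "D * s\<^sup>2 \<le> 2" unfolding s1 using \<beta> by (simp add: D_def)
    moreover have "X_crit \<alpha> \<beta> = 0" unfolding X using 3 by simp
    ultimately show ?thesis using 3 iff by (simp add: s_def)
  qed
qed

section \<open>Discs of values of the logarithmic derivative\<close>

text \<open>The map 1 / (1 - w) sends the disc of radius s about 0 to the disc with diameter from 1
  / (1 + s) to 1 / (1 - s). Both estimates of logarithmic derivatives below reduce to this
  one.\<close>

lemma inverse_one_minus_disc:
  fixes w :: complex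
  assumes "norm w \<le> s" "s < 1"
  shows "norm (1 / (1 - w) - of_real (1 / (1 - s\<^sup>2))) \<le> s / (1 - s\<^sup>2)"
proof -
  have s: "0 \<le> s" using assms(1) norm_ge_zero order_trans by blast
  then have s2: "0 < 1 - s\<^sup>2" using assms by (simp add: power_less_one_iff)
  have w: "1 - w \<noteq> 0" using assms by auto
  have "(norm (w - of_real (s\<^sup>2)))\<^sup>2 - (s * norm (1 - w))\<^sup>2 = ((norm w)\<^sup>2 - s\<^sup>2) * (1 - s\<^sup>2)"
    unfolding power_mult_distrib cmod_power2 by (simp add: power2_eq_square algebra_simps)
  also have "\<dots> \<le> 0"
    using s2 assms(1) by (intro mult_nonpos_nonneg) (auto simp: power_mono)
  finally have "(norm (w - of_real (s\<^sup>2)))\<^sup>2 \<le> (s * norm (1 - w))\<^sup>2" by linarith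
  then have le: "norm (w - of_real (s\<^sup>2)) \<le> s * norm (1 - w)"
    by (rule power2_le_imp_le) (use s in simp)
  have "1 / (1 - w) - of_real (1 / (1 - s\<^sup>2)) = (w - of_real (s\<^sup>2)) / ((1 - w) * of_real (1 - s\<^sup>2))"
  proof -
    have "of_real (1 - s\<^sup>2) \<noteq> (0::complex)" using s2 by (metis of_real_eq_0_iff less_irrefl)
    then have "1 / (1 - w) - 1 / of_real (1 - s\<^sup>2) = (of_real (1 - s\<^sup>2) - (1 - w)) / ((1 - w) * of_real (1 - s\<^sup>2))"
      using w by (subst diff_frac_eq) auto
    then show ?thesis by (simp add: of_real_divide)
  qed
  then have "norm (1 / (1 - w) - of_real (1 / (1 - s\<^sup>2))) = norm (w - of_real (s\<^sup>2)) / (norm (1 - w) * (1 - s\<^sup>2))"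
    using s2 by (simp only: norm_divide norm_mult norm_of_real abs_of_pos)
  also have "\<dots> \<le> s * norm (1 - w) / (norm (1 - w) * (1 - s\<^sup>2))"
    using le s2 by (intro divide_right_mono) auto
  also have "\<dots> = s / (1 - s\<^sup>2)" using w by simp
  finally show ?thesis .
qed

text \<open>The function f(z) / z extends over 0 with value f'(0) = 1 and has no zero in the disc,
  so the quotient is f' divided by this extension \<open>h\<close>.\<close>

lemma starlike_quot_holomorphic:
  assumes "f \<in> class_A" "nonvanishing_punctured f"
  shows "starlike_quot f holomorphic_on unit_disc"
proof -
  have f: "f holomorphic_on unit_disc" "f 0 = 0" "deriv f 0 = 1"
    using assms(1) by (auto simp: class_A_def)
  define h where "h = (\<lambda>z. if z = 0 then deriv f 0 else (f z - f 0) / (z - 0))"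
  have h: "h holomorphic_on unit_disc"
    unfolding h_def using f(1) by (rule pole_lemma) simp
  have "h z \<noteq> 0" if "z \<in> unit_disc" for z
    using that assms(2) f by (auto simp: h_def nonvanishing_punctured_def)
  then have "(\<lambda>z. deriv f z / h z) holomorphic_on unit_disc"
    using f(1) h by (intro holomorphic_intros) auto
  then show ?thesis
    by (rule holomorphic_transform) (auto simp: starlike_quot_def h_def f)
qed

lemma starlike_of_order_quot_disc:
  assumes "\<alpha> < 1" and f: "f \<in> starlike_of_order \<alpha>" and "norm z < 1"
  defines "s \<equiv> norm z"
  shows "norm (starlike_quot f z - of_real ((1 + (1 - 2 * \<alpha>) * s\<^sup>2) / (1 - s\<^sup>2)))
           \<le> (2 - 2 * \<alpha>) * s / (1 - s\<^sup>2)"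
proof -
  define p where "p = starlike_quot f"
  \<comment> \<open>The Moebius map of the half-plane Re > \<alpha> onto the unit disc that takes 1
    to 0, so the Schwarz lemma applies to \<open>w\<close>.\<close>
  define w where "w = (\<lambda>z. (p z - 1) / (p z + of_real (1 - 2 * \<alpha>)))"
  have Re: "Re (p z) > \<alpha>" if "norm z < 1" for z
    using f that by (auto simp: starlike_of_order_def p_def)
  have nz: "p z + of_real (1 - 2 * \<alpha>) \<noteq> 0" if "norm z < 1" for z
  proof -
    have "Re (p z + of_real (1 - 2 * \<alpha>)) > 0" using Re[OF that] assms(1) by simp
    then show ?thesis by (metis less_irrefl zero_complex.sel(1))
  qed
  have "p holomorphic_on unit_disc"
    using f unfolding p_def by (intro starlike_quot_holomorphic) (auto simp: starlike_of_order_def)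
  then have hol: "w holomorphic_on unit_disc"
    unfolding w_def using nz by (intro holomorphic_intros) auto
  have "norm (w z) < 1" if "norm z < 1" for z
  proof -
    have "(norm (p z - 1))\<^sup>2 < (norm (p z + of_real (1 - 2 * \<alpha>)))\<^sup>2"
    proof -
      \<comment> \<open>The points 1 and 2\<alpha> - 1 are mirror images in the line Re = \<alpha>;
        a value to the right of that line is closer to 1.\<close>
      have "(norm (p z + of_real (1 - 2 * \<alpha>)))\<^sup>2 - (norm (p z - 1))\<^sup>2 = 4 * (1 - \<alpha>) * (Re (p z) - \<alpha>)"
        unfolding cmod_power2 by (simp add: power2_eq_square algebra_simps)
      also have "\<dots> > 0" using Re[OF that] assms(1) by simp
      finally show ?thesis by simp
    qed
    then have "norm (p z - 1) < norm (p z + of_real (1 - 2 * \<alpha>))"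
      by (rule power2_less_imp_less) simp
    then show ?thesis using nz[OF that] by (simp add: w_def norm_divide)
  qed
  moreover have "w 0 = 0" by (simp add: w_def p_def starlike_quot_def)
  ultimately have ws: "norm (w z) \<le> s"
    unfolding s_def using hol assms(3) by (intro Schwarz_Lemma(1)) auto
  have s1: "s < 1" "0 \<le> s" using assms by (auto simp: s_def)
  then have s2: "1 - s\<^sup>2 > 0" by (simp add: power_less_one_iff)
  have w1: "1 - w z \<noteq> 0" using ws s1 by auto
  have "w z * (p z + of_real (1 - 2 * \<alpha>)) = p z - 1"
    using nz[OF assms(3)] by (simp add: w_def)
  then have "p z * (1 - w z) = of_real (2 * \<alpha> - 1) * (1 - w z) + of_real (2 - 2 * \<alpha>)"
    by (simp add: algebra_simps)
  then have p: "p z = of_real (2 * \<alpha> - 1) + of_real (2 - 2 * \<alpha>) * (1 / (1 - w z))"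
    using w1 by (simp add: field_simps)
  have "(1 + (1 - 2 * \<alpha>) * s\<^sup>2) / (1 - s\<^sup>2) = (2 * \<alpha> - 1) + (2 - 2 * \<alpha>) * (1 / (1 - s\<^sup>2))"
    using s2 by (simp add: field_simps)
  then have "p z - of_real ((1 + (1 - 2 * \<alpha>) * s\<^sup>2) / (1 - s\<^sup>2))
     = of_real (2 - 2 * \<alpha>) * (1 / (1 - w z) - of_real (1 / (1 - s\<^sup>2)))"
    unfolding p by (simp only: of_real_add of_real_mult) (simp add: algebra_simps)
  then have "norm (p z - of_real ((1 + (1 - 2 * \<alpha>) * s\<^sup>2) / (1 - s\<^sup>2)))
     = (2 - 2 * \<alpha>) * norm (1 / (1 - w z) - of_real (1 / (1 - s\<^sup>2)))"
    using assms(1) by (simp only: norm_mult norm_of_real abs_of_pos diff_gt_0_iff_gt)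
  also have "\<dots> \<le> (2 - 2 * \<alpha>) * (s / (1 - s\<^sup>2))"
    using inverse_one_minus_disc[OF ws s1(1)] assms(1) by (intro mult_left_mono) auto
  finally show ?thesis by (simp add: p_def)
qed

text \<open>Each zero a contributes z / (z - a) = 1 - 1 / (1 - z / a), where |z / a| is at most s
  because |a| is at least 1. By \<open>inverse_one_minus_disc\<close> this lies in the disc with
  centre \<open>- s\<^sup>2 / (1 - s\<^sup>2)\<close> and radius \<open>s / (1 - s\<^sup>2)\<close>;
  the discs add up over the zeros.\<close>

lemma poly_log_deriv_disc:
  fixes Q :: "complex poly" and s :: real
  assumes "\<And>x. poly Q x = 0 \<Longrightarrow> norm x \<ge> 1" and "norm z < 1"
  defines "s \<equiv> norm z"
  shows "norm (z * poly (pderiv Q) z / poly Q z + of_real (degree Q * s\<^sup>2 / (1 - s\<^sup>2)))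
           \<le> degree Q * s / (1 - s\<^sup>2)"
  using assms(1)
proof (induction "degree Q" arbitrary: Q)
  case 0
  then have "pderiv Q = 0" by (simp add: pderiv_eq_0_iff)
  then show ?case using 0 by simp
next
  case (Suc n)
  have s: "s < 1" "0 \<le> s" using assms by (auto simp: s_def)
  then have s2: "1 - s\<^sup>2 > 0" by (simp add: power_less_one_iff)
  obtain a where a: "poly Q a = 0"
    using alg_closed_imp_poly_has_root[of Q] Suc.hyps(2) by auto
  then obtain P where Q: "Q = [:-a, 1:] * P" by (auto simp: poly_eq_0_iff_dvd dvd_def)
  have "P \<noteq> 0" using Q Suc.hyps(2) by auto
  then have deg: "degree Q = Suc (degree P)"
    unfolding Q by (subst degree_mult_eq) auto
  have a1: "norm a \<ge> 1" using a Suc.prems by blast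
  then have a0: "a \<noteq> 0" "z \<noteq> a" using assms(2) by auto
  have Qz: "poly Q z \<noteq> 0" using Suc.prems assms(2) by force
  then have Pz: "poly P z \<noteq> 0" unfolding Q by auto
  define S where "S = of_real (1 / (1 - s\<^sup>2)) - 1 / (1 - z / a)"
  have "norm (z / a) \<le> s"
    using a1 a0 mult_left_mono[of 1 "norm a" "norm z"]
    by (simp add: s_def norm_divide divide_simps)
  then have S: "norm S \<le> s / (1 - s\<^sup>2)"
    unfolding S_def using inverse_one_minus_disc[OF _ s(1)] by (simp add: norm_minus_commute)
  have IH: "norm (z * poly (pderiv P) z / poly P z + of_real (degree P * s\<^sup>2 / (1 - s\<^sup>2)))
           \<le> degree P * s / (1 - s\<^sup>2)"
    using Suc.hyps deg Suc.prems unfolding Q by (intro Suc.hyps(1)) auto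
  have "s\<^sup>2 / (1 - s\<^sup>2) = 1 / (1 - s\<^sup>2) - 1" using s2 by (simp add: field_simps)
  moreover have "z / (z - a) = 1 - 1 / (1 - z / a)" using a0 by (simp add: field_simps)
  ultimately have S': "S = z / (z - a) + of_real (s\<^sup>2 / (1 - s\<^sup>2))"
    unfolding S_def by (simp only: of_real_diff) simp
  have "z * poly (pderiv Q) z / poly Q z = z / (z - a) + z * poly (pderiv P) z / poly P z"
    using Pz a0 unfolding Q pderiv_mult by (simp add: pderiv_pCons divide_simps) (simp add: algebra_simps)
  moreover have "degree Q * s\<^sup>2 / (1 - s\<^sup>2) = s\<^sup>2 / (1 - s\<^sup>2) + degree P * s\<^sup>2 / (1 - s\<^sup>2)"
    unfolding deg by (simp add: algebra_simps add_divide_distrib)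
  ultimately have "z * poly (pderiv Q) z / poly Q z + of_real (degree Q * s\<^sup>2 / (1 - s\<^sup>2))
    = S + (z * poly (pderiv P) z / poly P z + of_real (degree P * s\<^sup>2 / (1 - s\<^sup>2)))"
    unfolding S' by (simp only: of_real_add) (simp add: algebra_simps)
  also have "norm \<dots> \<le> s / (1 - s\<^sup>2) + degree P * s / (1 - s\<^sup>2)"
    using norm_triangle_mono[OF S IH] .
  also have "\<dots> = degree Q * s / (1 - s\<^sup>2)"
    unfolding deg by (simp add: algebra_simps add_divide_distrib)
  finally show ?case .
qed

text \<open>Differentiating exp L = Q gives L' = Q' / Q, in which no branch of the logarithm
  appears.\<close>

lemma power_branch_has_derivative:
  fixes Q :: "complex poly"
  assumes L: "L holomorphic_on unit_disc" "\<forall>z\<in>unit_disc. exp (L z) = poly Q z"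
    and z: "z \<in> unit_disc"
  shows "((\<lambda>z. exp (c * L z)) has_field_derivative
            c * (poly (pderiv Q) z / poly Q z) * exp (c * L z)) (at z)"
proof -
  have dL: "(L has_field_derivative deriv L z) (at z)"
    using L(1) z by (intro holomorphic_derivI[of _ unit_disc]) auto
  have "((\<lambda>z. exp (L z)) has_field_derivative exp (L z) * deriv L z) (at z)"
    using dL by (auto intro!: derivative_eq_intros)
  then have "(poly Q has_field_derivative exp (L z) * deriv L z) (at z)"
    by (rule has_field_derivative_transform_within_open[of _ _ _ unit_disc]) (use z L(2) in auto)
  then have "poly (pderiv Q) z = exp (L z) * deriv L z"
    using poly_DERIV DERIV_unique by blast
  then have "deriv L z = poly (pderiv Q) z / poly Q z"
    using L(2) z by (metis exp_not_eq_zero nonzero_mult_div_cancel_left)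
  then show ?thesis
    using dL by (auto intro!: derivative_eq_intros simp: ac_simps)
qed

lemma starlike_quot_family:
  fixes Q :: "complex poly"
  assumes f: "f \<in> class_A" "nonvanishing_punctured f"
    and g: "is_power_branch g (poly Q) c"
    and F: "\<forall>z\<in>unit_disc. F z = f z * g z"
  shows "F \<in> class_A" "nonvanishing_punctured F"
    and "\<And>z. z \<in> unit_disc \<Longrightarrow>
           starlike_quot F z = starlike_quot f z + of_real c * (z * poly (pderiv Q) z / poly Q z)"
proof -
  obtain L where L: "L holomorphic_on unit_disc" "L 0 = 0"
    "\<forall>z\<in>unit_disc. exp (L z) = poly Q z"
    "\<forall>z\<in>unit_disc. g z = exp (of_real c * L z)"
    using g by (auto simp: is_power_branch_def)
  let ?E = "\<lambda>z. exp (of_real c * L z)"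
  have F': "F z = f z * ?E z" if "z \<in> unit_disc" for z using that F L(4) by simp
  have f': "f holomorphic_on unit_disc" "f 0 = 0" "deriv f 0 = 1"
    using f(1) by (auto simp: class_A_def)
  have "(\<lambda>z. f z * ?E z) holomorphic_on unit_disc"
    using f' L(1) by (intro holomorphic_intros)
  then have hol: "F holomorphic_on unit_disc"
    by (rule holomorphic_transform) (simp add: F')
  have dF: "deriv F z = deriv f z * ?E z + f z * (of_real c * (poly (pderiv Q) z / poly Q z) * ?E z)"
    if z: "z \<in> unit_disc" for z
  proof -
    have "(f has_field_derivative deriv f z) (at z)"
      using f'(1) z by (intro holomorphic_derivI[of _ unit_disc]) auto
    from DERIV_mult'[OF this power_branch_has_derivative[OF L(1,3) z, of "of_real c"]] have "((\<lambda>z. f z * ?E z) has_field_derivative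
        (deriv f z * ?E z + f z * (of_real c * (poly (pderiv Q) z / poly Q z) * ?E z))) (at z)"
      by (simp only: add.commute)
    then have "(F has_field_derivative
        (deriv f z * ?E z + f z * (of_real c * (poly (pderiv Q) z / poly Q z) * ?E z))) (at z)"
      by (rule has_field_derivative_transform_within_open[of _ _ _ unit_disc]) (use z F' in auto)
    then show ?thesis by (rule DERIV_imp_deriv)
  qed
  show "F \<in> class_A" using hol F'[of 0] dF[of 0] f' L(2) by (simp add: class_A_def)
  show "nonvanishing_punctured F" using f(2) F' by (simp add: nonvanishing_punctured_def)
  fix z assume z: "z \<in> unit_disc"
  show "starlike_quot F z = starlike_quot f z + of_real c * (z * poly (pderiv Q) z / poly Q z)"
  proof (cases "z = 0")
    case False
    then have "f z \<noteq> 0" using f(2) z by (simp add: nonvanishing_punctured_def)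
    then show ?thesis
      using False F'[OF z] dF[OF z] by (simp add: starlike_quot_def field_simps)
  qed (simp add: starlike_quot_def)
qed

text \<open>The disc for f and \<beta> / n times the disc for Q are added. The degree n cancels, so
  the result is the same for every n.\<close>

lemma family_F_quot_disc:
  assumes "\<alpha> < 1" "\<beta> > 0" "n \<ge> 1" and F: "F \<in> family_F \<alpha> \<beta> n"
  shows "F \<in> class_A" "nonvanishing_punctured F"
    and "\<And>z s. norm z < 1 \<Longrightarrow> s = norm z \<Longrightarrow>
      norm (starlike_quot F z - of_real ((1 + (1 - 2 * \<alpha> - \<beta>) * s\<^sup>2) / (1 - s\<^sup>2)))
        \<le> (2 - 2 * \<alpha> + \<beta>) * s / (1 - s\<^sup>2)"
proof -
  obtain f g and Q :: "complex poly" where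
      f: "f \<in> starlike_of_order \<alpha>" and Q: "degree Q = n" "\<And>z. poly Q z = 0 \<Longrightarrow> z \<notin> unit_disc"
      and g: "is_power_branch g (poly Q) (\<beta> / real n)"
      and Fz: "\<forall>z\<in>unit_disc. F z = f z * g z"
    using F by (auto simp: family_F_def)
  have f': "f \<in> class_A" "nonvanishing_punctured f" using f by (auto simp: starlike_of_order_def)
  note * = starlike_quot_family[OF f' g Fz]
  show "F \<in> class_A" by (rule *(1))
  show "nonvanishing_punctured F" by (rule *(2))
  fix z :: complex and s assume z: "norm z < 1" and s: "s = norm z"
  let ?q = "z * poly (pderiv Q) z / poly Q z"
  let ?c = "\<beta> / real n"
  have 1: "norm (starlike_quot f z - of_real ((1 + (1 - 2 * \<alpha>) * s\<^sup>2) / (1 - s\<^sup>2)))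
           \<le> (2 - 2 * \<alpha>) * s / (1 - s\<^sup>2)"
    unfolding s by (rule starlike_of_order_quot_disc[OF assms(1) f z])
  have "norm (?q + of_real (n * s\<^sup>2 / (1 - s\<^sup>2))) \<le> n * s / (1 - s\<^sup>2)"
    unfolding s Q(1)[symmetric] using Q(2) z by (intro poly_log_deriv_disc) (auto simp: not_less)
  then have "norm (of_real ?c * (?q + of_real (n * s\<^sup>2 / (1 - s\<^sup>2)))) \<le> ?c * (n * s / (1 - s\<^sup>2))"
    unfolding norm_mult norm_of_real using assms by (intro mult_mono) auto
  also have "?c * (n * s / (1 - s\<^sup>2)) = \<beta> * s / (1 - s\<^sup>2)"
    using assms by simp
  finally have 2: "norm (of_real ?c * (?q + of_real (n * s\<^sup>2 / (1 - s\<^sup>2)))) \<le> \<beta> * s / (1 - s\<^sup>2)" .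
  have "(1 + (1 - 2 * \<alpha> - \<beta>) * s\<^sup>2) / (1 - s\<^sup>2) =
      (1 + (1 - 2 * \<alpha>) * s\<^sup>2) / (1 - s\<^sup>2) - ?c * (n * s\<^sup>2 / (1 - s\<^sup>2))"
    using assms by (simp add: diff_divide_distrib[symmetric] algebra_simps)
  then have "starlike_quot F z - of_real ((1 + (1 - 2 * \<alpha> - \<beta>) * s\<^sup>2) / (1 - s\<^sup>2)) =
     (starlike_quot f z - of_real ((1 + (1 - 2 * \<alpha>) * s\<^sup>2) / (1 - s\<^sup>2)))
     + of_real ?c * (?q + of_real (n * s\<^sup>2 / (1 - s\<^sup>2)))"
    using *(3)[of z] z by (simp only: of_real_diff of_real_mult) (simp add: algebra_simps)
  also have "norm \<dots> \<le> (2 - 2 * \<alpha>) * s / (1 - s\<^sup>2) + \<beta> * s / (1 - s\<^sup>2)"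
    by (rule norm_triangle_mono[OF 1 2])
  also have "\<dots> = (2 - 2 * \<alpha> + \<beta>) * s / (1 - s\<^sup>2)"
    by (simp add: add_divide_distrib[symmetric] algebra_simps)
  finally show "norm (starlike_quot F z - of_real ((1 + (1 - 2 * \<alpha> - \<beta>) * s\<^sup>2) / (1 - s\<^sup>2)))
        \<le> (2 - 2 * \<alpha> + \<beta>) * s / (1 - s\<^sup>2)" .
qed

lemma dilation_class_A:
  assumes r: "0 < r" "r < 1" and F: "F \<in> class_A" "nonvanishing_punctured F"
  shows "dilation r F \<in> class_A" "nonvanishing_punctured (dilation r F)"
    and "\<And>z. z \<in> unit_disc \<Longrightarrow> starlike_quot (dilation r F) z = starlike_quot F (of_real r * z)"
proof -
  have F': "F holomorphic_on unit_disc" "F 0 = 0" "deriv F 0 = 1"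
    using F(1) by (auto simp: class_A_def)
  have rz: "of_real r * z \<in> unit_disc" if "z \<in> unit_disc" for z :: complex
    using that r mult_strict_mono[of r 1 "norm z" 1] by (auto simp: norm_mult)
  have der: "(dilation r F has_field_derivative deriv F (of_real r * z)) (at z)"
    if "z \<in> unit_disc" for z
  proof -
    have "(F has_field_derivative deriv F (of_real r * z)) (at (of_real r * z))"
      using F'(1) rz[OF that] by (intro holomorphic_derivI[of _ unit_disc]) auto
    then show ?thesis
      unfolding dilation_def using r
      by (auto intro!: derivative_eq_intros DERIV_chain2[of F] simp: field_simps)
  qed
  then have d: "deriv (dilation r F) z = deriv F (of_real r * z)" if "z \<in> unit_disc" for z
    using that DERIV_imp_deriv by blast
  have "dilation r F holomorphic_on unit_disc"
    using der field_differentiable_at_within field_differentiable_def holomorphic_on_def by metis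
  then show "dilation r F \<in> class_A"
    using d[of 0] F' by (simp add: class_A_def dilation_def)
  show "nonvanishing_punctured (dilation r F)"
    using F(2) rz r by (auto simp: nonvanishing_punctured_def dilation_def)
  show "starlike_quot (dilation r F) z = starlike_quot F (of_real r * z)" if "z \<in> unit_disc" for z
    using d[OF that] r by (simp add: starlike_quot_def dilation_def field_simps)
qed

section \<open>The cardioid domain\<close>

lemma cardioid_map_eq: "cardioid_map z = 1 / 3 + 2 / 3 * (1 + z)\<^sup>2"
  by (simp add: cardioid_map_def power2_eq_square field_simps)

text \<open>The square of the disc |\<zeta> - 1| < 1 meets the real axis in the interval (0, 4). The
  claim is that for c in this interval no point outside the squared disc is closer to c than the
  nearer endpoint. With m = |p|, a root outside the disc means \<open>2 * x \<le> m\<close>.\<close>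

lemma csqrt_near_1:
  fixes p :: complex and c d :: real
  assumes "norm (p - of_real c) \<le> d" "d < c" "d < 4 - c"
  shows "norm (csqrt p - 1) < 1"
proof (rule ccontr)
  assume "\<not> norm (csqrt p - 1) < 1"
  define x y where "x = Re (csqrt p)" and "y = Im (csqrt p)"
  define m where "m = x\<^sup>2 + y\<^sup>2"
  have x: "x \<ge> 0" using csqrt_principal[of p] by (auto simp: x_def)
  have "1 \<le> (norm (csqrt p - 1))\<^sup>2"
    using \<open>\<not> norm (csqrt p - 1) < 1\<close> by simp
  then have mx: "2 * x \<le> m"
    unfolding cmod_power2 by (simp add: x_def y_def m_def power2_eq_square algebra_simps)
  have d0: "0 \<le> d" using assms(1) norm_ge_zero order_trans by blast
  have c: "0 < c" "c < 4" using assms d0 by auto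
  have p: "p = (csqrt p)\<^sup>2" by simp
  have pre: "Re p = x\<^sup>2 - y\<^sup>2" "Im p = 2 * x * y"
    by (subst p, simp only: Re_power2 Im_power2 x_def y_def)+
  have eq: "(norm (p - of_real c))\<^sup>2 = m\<^sup>2 - 2 * c * (2 * x\<^sup>2 - m) + c\<^sup>2"
    unfolding cmod_power2 by (simp add: pre m_def power2_eq_square algebra_simps)
  \<comment> \<open>The bound \<open>ge1\<close> is the squared distance from c to the point of the
    boundary curve m = 2 x with the same modulus m; \<open>x \<ge> 0\<close>, the choice of the
    principal root, is what permits squaring.\<close>
  have "(2 * x)\<^sup>2 \<le> m\<^sup>2" using x mx by (intro power_mono) auto
  then have "c * (4 * x\<^sup>2) \<le> c * m\<^sup>2" using c by (intro mult_left_mono) (auto simp: power_mult_distrib)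
  then have ge1: "(norm (p - of_real c))\<^sup>2 \<ge> m\<^sup>2 - c * (m\<^sup>2 - 2 * m) + c\<^sup>2"
    unfolding eq by (simp add: algebra_simps)
  \<comment> \<open>\<open>ge2\<close> is the distance along the real axis, sufficient when m is at
    least 4, beyond the boundary curve.\<close>
  have "c * x\<^sup>2 \<le> c * m" using c by (intro mult_left_mono) (auto simp: m_def)
  then have ge2: "(norm (p - of_real c))\<^sup>2 \<ge> (m - c)\<^sup>2"
    unfolding eq by (simp add: power2_eq_square algebra_simps)
  have m0: "m \<ge> 0" using x mx by simp
  have "d\<^sup>2 < (norm (p - of_real c))\<^sup>2"
  proof (cases "m \<ge> 4")
    case True
    have "d\<^sup>2 < (m - c)\<^sup>2" using True assms d0 by (intro power_strict_mono) auto
    then show ?thesis using ge2 by linarith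
  next
    case False
    show ?thesis
    proof (cases "c \<ge> 1")
      case c1: True
      \<comment> \<open>For c at least 1 the bound \<open>ge1\<close> is concave in m, so on [0, 4]
        it lies above its chord from \<open>c\<^sup>2\<close> to
        \<open>(4 - c)\<^sup>2\<close>.\<close>
      have "4 * d\<^sup>2 = (4 - m) * d\<^sup>2 + m * d\<^sup>2" by (simp add: algebra_simps)
      also have "\<dots> < (4 - m) * c\<^sup>2 + m * (4 - c)\<^sup>2"
        using False m0 d0 assms
        by (intro add_less_le_mono mult_strict_left_mono mult_left_mono power_mono power_strict_mono) auto
      also have "\<dots> \<le> (4 - m) * c\<^sup>2 + m * (4 - c)\<^sup>2 + 4 * (c - 1) * (m * (4 - m))"
        using c1 m0 False by simp
      also have "\<dots> = 4 * (m\<^sup>2 - c * (m\<^sup>2 - 2 * m) + c\<^sup>2)"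
        by (simp add: power2_eq_square algebra_simps)
      finally have "d\<^sup>2 < m\<^sup>2 - c * (m\<^sup>2 - 2 * m) + c\<^sup>2"
        by (simp only: mult_less_cancel_left_pos zero_less_numeral)
      then show ?thesis using ge1 by (rule less_le_trans)
    next
      case c1: False
      have "m\<^sup>2 - c * (m\<^sup>2 - 2 * m) + c\<^sup>2 = m\<^sup>2 * (1 - c) + 2 * (c * m) + c\<^sup>2"
        by (simp add: algebra_simps)
      also have "\<dots> \<ge> c\<^sup>2" using c1 c m0 by simp
      finally have "c\<^sup>2 \<le> (norm (p - of_real c))\<^sup>2" using ge1 by linarith
      moreover have "d\<^sup>2 < c\<^sup>2" using d0 assms by (intro power_strict_mono) auto
      ultimately show ?thesis by linarith
    qed
  qed
  then show False using assms(1) power_mono[OF assms(1), of 2] by simp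
qed

text \<open>The Schwarz function is found by solving q = 1/3 + (2/3) (1 + w)^2 for \<open>w\<close>
  with the principal root, which is analytic because the discs force Re p > 0. The affine change
  from q to p takes 1/3 and 3 to 0 and 4, the endpoints in \<open>csqrt_near_1\<close>.\<close>

lemma subordinate_cardioidI:
  assumes q: "q holomorphic_on unit_disc" "q 0 = 1"
    and disc: "\<And>z. z \<in> unit_disc \<Longrightarrow> \<exists>a \<rho>. norm (q z - of_real a) \<le> \<rho> \<and> \<rho> < a - 1 / 3 \<and> \<rho> < 3 - a"
  shows "subordinate q cardioid_map"
proof -
  define p where "p = (\<lambda>z. 3 / 2 * (q z - 1 / 3))"
  define w where "w = (\<lambda>z. csqrt (p z) - 1)"
  have *: "norm (w z) < 1" "p z \<notin> \<real>\<^sub>\<le>\<^sub>0" if z: "z \<in> unit_disc" for z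
  proof -
    obtain a \<rho> where a: "norm (q z - of_real a) \<le> \<rho>" "\<rho> < a - 1 / 3" "\<rho> < 3 - a"
      using disc[OF z] by blast
    have "p z - of_real (3 / 2 * (a - 1 / 3)) = of_real (3 / 2) * (q z - of_real a)"
      by (simp add: p_def field_simps)
    then have "norm (p z - of_real (3 / 2 * (a - 1 / 3))) = 3 / 2 * norm (q z - of_real a)"
      by (simp only: norm_mult norm_of_real)
    then have le: "norm (p z - of_real (3 / 2 * (a - 1 / 3))) \<le> 3 / 2 * \<rho>" using a by simp
    have "4 - 3 / 2 * (a - 1 / 3) = 3 / 2 * (3 - a)" by (simp add: field_simps)
    then have "3 / 2 * \<rho> < 3 / 2 * (a - 1 / 3)" "3 / 2 * \<rho> < 4 - 3 / 2 * (a - 1 / 3)"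
      using a by (simp_all only:) simp_all
    then show "norm (w z) < 1"
      unfolding w_def by (rule csqrt_near_1[OF le])
    have "Re (q z) > 1 / 3" using abs_Re_le_cmod[of "q z - of_real a"] a by simp
    then have "Re (p z) > 0" by (simp add: p_def)
    then show "p z \<notin> \<real>\<^sub>\<le>\<^sub>0" by (auto simp: complex_nonpos_Reals_iff)
  qed
  have "p holomorphic_on unit_disc"
    unfolding p_def using q(1) by (intro holomorphic_intros)
  then have "w holomorphic_on unit_disc"
    unfolding w_def using *(2) by (intro holomorphic_intros)
  moreover have "w 0 = 0" by (simp add: w_def p_def q(2))
  moreover have "q z = cardioid_map (w z)" for z
    by (simp add: cardioid_map_eq w_def p_def) (simp add: field_simps)
  moreover have "cardioid_map holomorphic_on unit_disc"
    unfolding cardioid_map_def by (intro holomorphic_intros) auto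
  ultimately show ?thesis
    using *(1) q(1) unfolding subordinate_def by (intro conjI exI[of _ w]) auto
qed

lemma cardioid_map_avoids:
  assumes "w \<in> unit_disc"
  shows "cardioid_map w \<noteq> 1 / 3" "cardioid_map w \<noteq> 3"
proof -
  have w: "w \<noteq> -1" "w \<noteq> 1" "w \<noteq> -3" using assms by auto
  show "cardioid_map w \<noteq> 1 / 3"
  proof
    assume "cardioid_map w = 1 / 3"
    then have "1 + w = 0" by (simp add: cardioid_map_eq)
    with w show False by (metis add_eq_0_iff)
  qed
  show "cardioid_map w \<noteq> 3"
  proof
    assume "cardioid_map w = 3"
    then have "(1 + w)\<^sup>2 = 4" by (simp add: cardioid_map_eq field_simps)
    then have "(w - 1) * (w + 3) = 0" by (simp add: power2_eq_square algebra_simps)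
    then have "w = 1 \<or> w = -3" by (metis mult_eq_0_iff right_minus_eq add_eq_0_iff2)
    with w show False by blast
  qed
qed

section \<open>The extremal function\<close>

text \<open>The Koebe function of order \<alpha>, z / (1 - z)^(2 - 2\<alpha>). The principal
  logarithm is safe since 1 - z has positive real part on the disc.\<close>

definition koebe :: "real \<Rightarrow> complex \<Rightarrow> complex" where
  "koebe \<alpha> z = z * exp (- of_real (2 - 2 * \<alpha>) * Ln (1 - z))"

lemma one_minus_notin_nonpos_Reals:
  "z \<in> unit_disc \<Longrightarrow> 1 - z \<notin> \<real>\<^sub>\<le>\<^sub>0" "z \<in> unit_disc \<Longrightarrow> 1 + z \<notin> \<real>\<^sub>\<le>\<^sub>0"
  using abs_Re_le_cmod[of z] by (auto simp: complex_nonpos_Reals_iff)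

lemma koebe_starlike:
  assumes "\<alpha> < 1"
  shows "koebe \<alpha> \<in> starlike_of_order \<alpha>"
    and "\<And>z. z \<in> unit_disc \<Longrightarrow> starlike_quot (koebe \<alpha>) z = 1 + of_real (2 - 2 * \<alpha>) * (z / (1 - z))"
proof -
  let ?E = "\<lambda>z. exp (- of_real (2 - 2 * \<alpha>) * Ln (1 - z))"
  have der: "(koebe \<alpha> has_field_derivative ?E z * (1 + of_real (2 - 2 * \<alpha>) * (z / (1 - z)))) (at z)"
    if "z \<in> unit_disc" for z
  proof -
    have "z \<noteq> 1" using that by auto
    define c :: complex where "c = of_real (2 - 2 * \<alpha>)"
    have "((\<lambda>z. exp (- c * Ln (1 - z))) has_field_derivative c / (1 - z) * exp (- c * Ln (1 - z))) (at z)"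
      using one_minus_notin_nonpos_Reals[OF that] \<open>z \<noteq> 1\<close>
      by (auto intro!: derivative_eq_intros simp: divide_inverse)
    from DERIV_mult'[OF DERIV_ident this] show ?thesis
      unfolding koebe_def [abs_def] c_def[symmetric] by (simp add: algebra_simps)
  qed
  then have d: "deriv (koebe \<alpha>) z = ?E z * (1 + of_real (2 - 2 * \<alpha>) * (z / (1 - z)))"
    if "z \<in> unit_disc" for z using that DERIV_imp_deriv by blast
  show sq: "starlike_quot (koebe \<alpha>) z = 1 + of_real (2 - 2 * \<alpha>) * (z / (1 - z))" if "z \<in> unit_disc" for z
    using d[OF that] by (simp add: starlike_quot_def koebe_def)
  have "Re (starlike_quot (koebe \<alpha>) z) > \<alpha>" if z: "z \<in> unit_disc" for z
  proof -
    have nz: "1 - z \<noteq> 0" using z by auto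
    have "(norm z)\<^sup>2 < 1" using z by (simp add: power_less_one_iff)
    \<comment> \<open>This is |z| < 1 rearranged to say that z / (1 - z) has real part above
      -1/2.\<close>
    then have "2 * (Re z * (1 - Re z) - (Im z)\<^sup>2) > - ((1 - Re z)\<^sup>2 + (Im z)\<^sup>2)"
      unfolding cmod_power2 by (simp add: power2_eq_square algebra_simps)
    moreover have "(1 - Re z)\<^sup>2 + (Im z)\<^sup>2 > 0"
      using nz zero_less_norm_iff[of "1 - z"] cmod_power2[of "1 - z"]
      by (metis minus_complex.sel one_complex.sel diff_0 power2_minus zero_less_power)
    ultimately have "Re (z / (1 - z)) > - 1 / 2"
      by (simp add: Re_divide divide_simps power2_eq_square algebra_simps)
    then have "(1 - \<alpha>) * (1 + 2 * Re (z / (1 - z))) > 0"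
      using assms by (intro mult_pos_pos) auto
    moreover have "Re (starlike_quot (koebe \<alpha>) z) = 1 + (2 - 2 * \<alpha>) * Re (z / (1 - z))"
      unfolding sq[OF z] times_complex.sel plus_complex.sel by simp
    ultimately show ?thesis by (simp add: algebra_simps)
  qed
  moreover have "koebe \<alpha> holomorphic_on unit_disc"
    using der field_differentiable_at_within field_differentiable_def holomorphic_on_def by metis
  ultimately show "koebe \<alpha> \<in> starlike_of_order \<alpha>"
    using d[of 0] by (auto simp: starlike_of_order_def class_A_def nonvanishing_punctured_def koebe_def)
qed

definition extremal :: "real \<Rightarrow> real \<Rightarrow> complex \<Rightarrow> complex" where
  "extremal \<alpha> \<beta> z = koebe \<alpha> z * exp (of_real \<beta> * Ln (1 + z))"

text \<open>All zeros of Q are placed at -1: the power \<beta> / n of (1 + z)^n is (1 + z)^\<beta>,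
  so one function serves every n.\<close>

lemma extremal_family:
  assumes "\<alpha> < 1" "\<beta> > 0" "n \<ge> 1"
  shows "extremal \<alpha> \<beta> \<in> family_F \<alpha> \<beta> n"
    and "\<And>z. z \<in> unit_disc \<Longrightarrow> starlike_quot (extremal \<alpha> \<beta>) z =
           1 + of_real (2 - 2 * \<alpha>) * (z / (1 - z)) + of_real \<beta> * (z / (1 + z))"
proof -
  define Q :: "complex poly" where "Q = [:1, 1:] ^ n"
  define g where "g = (\<lambda>z. exp (of_real \<beta> * Ln (1 + z)))"
  note K = koebe_starlike[OF assms(1)]
  have K': "koebe \<alpha> \<in> class_A" "nonvanishing_punctured (koebe \<alpha>)"
    using K(1) by (auto simp: starlike_of_order_def)
  have nz: "1 + z \<noteq> 0" if "z \<in> unit_disc" for z :: complex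
    using one_minus_notin_nonpos_Reals(2)[OF that] by auto
  have g: "is_power_branch g (poly Q) (\<beta> / real n)"
    unfolding is_power_branch_def
  \<comment> \<open>The analytic logarithm of Q is n times \<open>Ln (1 + z)\<close>; the principal
    logarithm of the n-th power could jump.\<close>
  proof (intro exI[of _ "\<lambda>z. of_nat n * Ln (1 + z)"] conjI ballI)
    show "(\<lambda>z. of_nat n * Ln (1 + z)) holomorphic_on unit_disc"
      using one_minus_notin_nonpos_Reals by (intro holomorphic_intros) auto
    fix z :: complex assume z: "z \<in> unit_disc"
    show "exp (of_nat n * Ln (1 + z)) = poly Q z"
      using nz[OF z] by (simp add: exp_of_nat_mult Q_def)
    show "g z = exp (of_real (\<beta> / real n) * (of_nat n * Ln (1 + z)))"
      using assms by (simp add: g_def)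
  qed simp
  have F: "\<forall>z\<in>unit_disc. extremal \<alpha> \<beta> z = koebe \<alpha> z * g z" by (simp add: extremal_def g_def)
  have "degree Q = n" "poly Q 0 = 1"
    by (simp_all add: Q_def degree_power_eq)
  moreover have "poly Q z = 0 \<Longrightarrow> z \<notin> unit_disc" for z
    using nz[of z] by (auto simp: Q_def)
  ultimately show "extremal \<alpha> \<beta> \<in> family_F \<alpha> \<beta> n"
    unfolding family_F_def using K(1) g F by blast
  fix z :: complex assume z: "z \<in> unit_disc"
  have dQ: "pderiv Q = smult (of_nat n) ([:1, 1:] ^ (n - 1))"
    using assms(3) unfolding Q_def pderiv_power by (simp add: pderiv_pCons)
  define u where "u = 1 + z"
  have u: "u \<noteq> 0" using nz[OF z] by (simp add: u_def)
  have "poly (pderiv Q) z = of_nat n * u ^ (n - 1)"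
    unfolding dQ u_def by simp
  moreover have "poly Q z = u * u ^ (n - 1)"
    using assms(3) unfolding Q_def u_def by (cases n) (simp_all add: algebra_simps)
  ultimately have "of_real (\<beta> / real n) * (z * poly (pderiv Q) z / poly Q z) = of_real \<beta> * (z / u)"
    using u assms(3) by (simp only:) (simp add: divide_simps)
  then have "of_real (\<beta> / real n) * (z * poly (pderiv Q) z / poly Q z) = of_real \<beta> * (z / (1 + z))"
    by (simp only: u_def)
  then show "starlike_quot (extremal \<alpha> \<beta>) z =
           1 + of_real (2 - 2 * \<alpha>) * (z / (1 - z)) + of_real \<beta> * (z / (1 + z))"
    using starlike_quot_family(3)[OF K' g F z] K(2)[OF z] by simp
qed

text \<open>At x = -s and x = s this value is the left and the right end of the real diameter of the
  disc in \<open>family_F_quot_disc\<close>, so that disc cannot be improved on the real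
  axis.\<close>

lemma starlike_quot_extremal_real:
  assumes "\<alpha> < 1" "\<beta> > 0" "\<bar>x\<bar> < 1"
  shows "starlike_quot (extremal \<alpha> \<beta>) (of_real x) =
           of_real (1 + (2 - 2 * \<alpha>) * (x / (1 - x)) + \<beta> * (x / (1 + x)))"
  using extremal_family(2)[of \<alpha> \<beta> 1 "of_real x"] assms by simp

text \<open>After clearing denominators, the value 1/3 at -s is exactly the quadratic equation
  defining \<open>sigma0\<close>.\<close>

lemma extremal_at_sigma0:
  assumes "\<alpha> < 1" "\<beta> > 0"
  shows "starlike_quot (extremal \<alpha> \<beta>) (of_real (- sigma0 \<alpha> \<beta>)) = 1 / 3"
proof -
  define s where "s = sigma0 \<alpha> \<beta>"
  have A: "6 - 6 * \<alpha> + 3 * \<beta> > 0" "6 - 6 * \<alpha> + 3 * \<beta> + (6 * \<alpha> + 3 * \<beta> - 4) > 2"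
    using assms by auto
  have s: "0 < s" "s < 1" "2 - (6 - 6 * \<alpha> + 3 * \<beta>) * s - (6 * \<alpha> + 3 * \<beta> - 4) * s\<^sup>2 = 0"
    unfolding s_def sigma0_eq using quad_root[OF A] by auto
  have "1 + (2 - 2 * \<alpha>) * (- s / (1 - (- s))) + \<beta> * (- s / (1 + - s)) = 1 / 3"
    using s by (simp add: divide_simps power2_eq_square) (simp add: algebra_simps)
  moreover have "\<bar>- s\<bar> < 1" using s by simp
  note starlike_quot_extremal_real[OF assms this]
  ultimately show ?thesis unfolding s_def[symmetric] by (simp only: of_real_divide) simp
qed

lemma extremal_at_sigma0_tilde:
  assumes "\<alpha> < 1" "\<beta> > 0"
  shows "starlike_quot (extremal \<alpha> \<beta>) (of_real (sigma0_tilde \<alpha> \<beta>)) = 3"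
proof -
  define s where "s = sigma0_tilde \<alpha> \<beta>"
  have A: "2 - 2 * \<alpha> + \<beta> > 0" "2 - 2 * \<alpha> + \<beta> + (4 - 2 * \<alpha> - \<beta>) > 2"
    using assms by auto
  have s: "0 < s" "s < 1" "2 - (2 - 2 * \<alpha> + \<beta>) * s - (4 - 2 * \<alpha> - \<beta>) * s\<^sup>2 = 0"
    unfolding s_def sigma0_tilde_eq using quad_root[OF A] by auto
  have "1 + (2 - 2 * \<alpha>) * (s / (1 - s)) + \<beta> * (s / (1 + s)) = 3"
    using s by (simp add: divide_simps power2_eq_square) (simp add: algebra_simps)
  moreover have "\<bar>s\<bar> < 1" using s by simp
  note starlike_quot_extremal_real[OF assms this]
  ultimately show ?thesis unfolding s_def[symmetric] by (simp only: of_real_divide) simp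
qed

section \<open>The radius\<close>

lemma radius_admissible_min:
  assumes "\<alpha> < 1" "\<beta> > 0" "n \<ge> 1"
  shows "radius_admissible starlike_cardioid (family_F \<alpha> \<beta> n)
           (min (sigma0 \<alpha> \<beta>) (sigma0_tilde \<alpha> \<beta>))"
proof -
  have A: "6 - 6 * \<alpha> + 3 * \<beta> > 0" "6 - 6 * \<alpha> + 3 * \<beta> + (6 * \<alpha> + 3 * \<beta> - 4) > 2"
    and A': "2 - 2 * \<alpha> + \<beta> > 0" "2 - 2 * \<alpha> + \<beta> + (4 - 2 * \<alpha> - \<beta>) > 2"
    using assms by auto
  let ?R = "min (sigma0 \<alpha> \<beta>) (sigma0_tilde \<alpha> \<beta>)"
  have R: "0 < ?R" "?R < 1"
    unfolding sigma0_eq sigma0_tilde_eq using quad_root[OF A] quad_root[OF A'] by auto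
  have "dilation r F \<in> starlike_cardioid" if F: "F \<in> family_F \<alpha> \<beta> n" and r: "0 < r" "r < ?R" for F r
  proof -
    have r1: "r < 1" using r R by linarith
    note F' = family_F_quot_disc[OF assms F]
    note D = dilation_class_A[OF r(1) r1 F'(1,2)]
    have "subordinate (starlike_quot (dilation r F)) cardioid_map"
    proof (rule subordinate_cardioidI)
      show "starlike_quot (dilation r F) holomorphic_on unit_disc"
        by (rule starlike_quot_holomorphic[OF D(1,2)])
      show "starlike_quot (dilation r F) 0 = 1" by (simp add: starlike_quot_def)
      fix z :: complex assume z: "z \<in> unit_disc"
      define s where "s = r * norm z"
      have "s \<le> r" using r z by (simp add: s_def mult_left_le)
      then have s: "s < ?R" and s1: "s < 1" using r(2) r1 by linarith+
      have "0 \<le> s" using r by (simp add: s_def)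
      have s2: "1 - s\<^sup>2 > 0" using s1 \<open>0 \<le> s\<close> by (simp add: power_less_one_iff)
      have "sgn (2 - (6 - 6 * \<alpha> + 3 * \<beta>) * s - (6 * \<alpha> + 3 * \<beta> - 4) * s\<^sup>2) = 1"
        using s \<open>0 \<le> s\<close> s1 quad_sgn[OF A, of s] by (simp add: sigma0_eq)
      then have P: "2 - (6 - 6 * \<alpha> + 3 * \<beta>) * s - (6 * \<alpha> + 3 * \<beta> - 4) * s\<^sup>2 > 0"
        by (simp add: sgn_1_pos)
      have "sgn (2 - (2 - 2 * \<alpha> + \<beta>) * s - (4 - 2 * \<alpha> - \<beta>) * s\<^sup>2) = 1"
        using s \<open>0 \<le> s\<close> s1 quad_sgn[OF A', of s] by (simp add: sigma0_tilde_eq)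
      then have P': "2 - (2 - 2 * \<alpha> + \<beta>) * s - (4 - 2 * \<alpha> - \<beta>) * s\<^sup>2 > 0"
        by (simp add: sgn_1_pos)
      let ?a = "(1 + (1 - 2 * \<alpha> - \<beta>) * s\<^sup>2) / (1 - s\<^sup>2)" and ?\<rho> = "(2 - 2 * \<alpha> + \<beta>) * s / (1 - s\<^sup>2)"
      have sn: "s = norm (of_real r * z)" using r by (simp add: s_def norm_mult)
      have "norm (starlike_quot (dilation r F) z - of_real ?a) \<le> ?\<rho>"
        unfolding D(3)[OF z] using F'(3)[OF _ sn] s1 sn by simp
      \<comment> \<open>The gaps between the disc and the points 1/3 and 3 are the two quadratics
        divided by positive factors, and both quadratics are positive for s below the minimum of the
        roots.\<close>
      moreover have "?a - 1 / 3 - ?\<rho> =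
          (2 - (6 - 6 * \<alpha> + 3 * \<beta>) * s - (6 * \<alpha> + 3 * \<beta> - 4) * s\<^sup>2) / (3 * (1 - s\<^sup>2))"
        using s2 by (simp add: divide_simps) (simp add: algebra_simps)
      then have "?\<rho> < ?a - 1 / 3" using P s2 by (smt (verit) divide_pos_pos)
      moreover have "3 - ?a - ?\<rho> =
          (2 - (2 - 2 * \<alpha> + \<beta>) * s - (4 - 2 * \<alpha> - \<beta>) * s\<^sup>2) / (1 - s\<^sup>2)"
        using s2 by (simp add: divide_simps) (simp add: algebra_simps)
      then have "?\<rho> < 3 - ?a" using P' s2 by (smt (verit) divide_pos_pos)
      ultimately show "\<exists>a \<rho>. norm (starlike_quot (dilation r F) z - of_real a) \<le> \<rho> \<and> \<rho> < a - 1 / 3 \<and> \<rho> < 3 - a"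
        by blast
    qed
    then show ?thesis using D by (simp add: starlike_cardioid_def)
  qed
  then show ?thesis using R by (auto simp: radius_admissible_def)
qed

text \<open>For |z| < r < R, the quotient of F at z is the quotient of the dilation by r at z / r, a
  point of the disc, and hence a value of the cardioid map there.\<close>

lemma radius_admissible_avoids:
  assumes R: "radius_admissible starlike_cardioid \<F> R" and F: "F \<in> \<F>" "F \<in> class_A" "nonvanishing_punctured F"
    and z: "norm z < R"
  shows "starlike_quot F z \<noteq> 1 / 3" "starlike_quot F z \<noteq> 3"
proof -
  obtain r where r: "norm z < r" "r < R" using z dense by blast
  then have r': "0 < r" "r < 1"
    using R norm_ge_zero[of z] unfolding radius_admissible_def by linarith+
  then have "dilation r F \<in> starlike_cardioid"
    using R F r by (auto simp: radius_admissible_def)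
  then obtain w where w: "w ` unit_disc \<subseteq> unit_disc"
    "\<And>z. z \<in> unit_disc \<Longrightarrow> starlike_quot (dilation r F) z = cardioid_map (w z)"
    by (auto simp: starlike_cardioid_def subordinate_def)
  have zr: "z / of_real r \<in> unit_disc" using r r' by (simp add: norm_divide)
  then have "w (z / of_real r) \<in> unit_disc" using w(1) by blast
  moreover have "starlike_quot F z = cardioid_map (w (z / of_real r))"
    using w(2)[OF zr] dilation_class_A(3)[OF r' F(2,3) zr] r' by simp
  ultimately show "starlike_quot F z \<noteq> 1 / 3" "starlike_quot F z \<noteq> 3"
    using cardioid_map_avoids by auto
qed

theorem theorem4p2:
  fixes \<alpha> \<beta> :: real and n :: nat
  assumes "0 \<le> \<alpha>" and "\<alpha> < 1" and "\<beta> > 0" and "n \<ge> 1"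
    and nondegenerate: "6*\<alpha> + 3*\<beta> = 4 \<Longrightarrow> \<alpha> \<le> (5 - sqrt 2) / 6"
  shows "is_radius starlike_cardioid (family_F \<alpha> \<beta> n)
           (if 2*\<alpha> + \<beta> - 2 \<ge> 0 then sigma0 \<alpha> \<beta>
            else if X_crit \<alpha> \<beta> \<le> 0 then sigma0 \<alpha> \<beta>
            else sigma0_tilde \<alpha> \<beta>)"
proof -
  have pos: "sigma0 \<alpha> \<beta> > 0" "sigma0_tilde \<alpha> \<beta> > 0"
    using radius_admissible_min[OF assms(2,3,4)] by (auto simp: radius_admissible_def)
  note E = extremal_family(1)[OF assms(2,3,4)]
  have "R \<le> min (sigma0 \<alpha> \<beta>) (sigma0_tilde \<alpha> \<beta>)"
    if R: "radius_admissible starlike_cardioid (family_F \<alpha> \<beta> n) R" for R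
  proof -
    note avoids = radius_admissible_avoids[OF R E family_F_quot_disc(1,2)[OF assms(2,3,4) E]]
    \<comment> \<open>Otherwise the point -\<open>sigma0\<close> would lie within |z| < R, where the
      extremal quotient must avoid 1/3; likewise for \<open>sigma0_tilde\<close> and 3.\<close>
    have "\<not> sigma0 \<alpha> \<beta> < R"
      using avoids(1)[of "of_real (- sigma0 \<alpha> \<beta>)"] extremal_at_sigma0[OF assms(2,3)] pos
      unfolding norm_of_real by linarith
    moreover have "\<not> sigma0_tilde \<alpha> \<beta> < R"
      using avoids(2)[of "of_real (sigma0_tilde \<alpha> \<beta>)"] extremal_at_sigma0_tilde[OF assms(2,3)] pos
      unfolding norm_of_real by linarith
    ultimately show ?thesis by simp
  qed
  then have "is_radius starlike_cardioid (family_F \<alpha> \<beta> n) (min (sigma0 \<alpha> \<beta>) (sigma0_tilde \<alpha> \<beta>))"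
    using radius_admissible_min[OF assms(2,3,4)] by (auto simp only: is_radius_def)
  \<comment> \<open>On this line \<open>X_crit\<close> is 0 and the formula selects
    \<open>sigma0\<close>; \<open>nondegenerate\<close> ensures that this is the minimum.\<close>
  moreover have "6*\<alpha> + 3*\<beta> = 4 \<longrightarrow> \<alpha> \<le> (5 - sqrt 2) / 6"
    using nondegenerate by blast
  ultimately show ?thesis
    by (simp only: radius_eq_min[OF assms(2,3)])
qed

end
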